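(* Let $X=\mathbb{R}^J$, let $f\in\Gamma_0(X)$ be a convex function of Legendre type satisfying (A1)--(A4) listed in the context, and let $U=\operatorname{int}\operatorname{dom} f$. Let $\theta\in\Gamma_0(X)$ be such that $U\cap\operatorname{dom}\theta\neq\varnothing$ and let $x,y\in U$. Then the following hold: (i) If there is some $\mu\in\,]0,+\infty[$ such that for every $v\in U$ the function $\theta(\cdot)+\frac1\mu D_f(\cdot,v)$ is coercive, then, as $\gamma\downarrow0$, $\overleftarrow{\operatorname{env}}_\theta^{\gamma}(y)\uparrow\theta(y)$, $\theta(\overleftarrow{P}_{\gamma\theta}(y))\uparrow\theta(y)$, and $\frac1\gamma D_f(\overleftarrow{P}_{\gamma\theta}(y),y)\to0$. (ii) If there is some $\mu\in\,]0,+\infty[$ such that for every $u\in U$ the function $\theta(\cdot)+\frac1\mu D_f(u,\cdot)$ is coercive, then, as $\gamma\downarrow0$, $\overrightarrow{\operatorname{env}}_\theta^{\gamma}(x)\uparrow\theta(x)$, $\theta(\overrightarrow{P}_{\gamma\theta}(x))\uparrow\theta(x)$, and $\frac1\gamma D_f(x,\overrightarrow{P}_{\gamma\theta}(x))\to0$.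
   Context: $X=\mathbb{R}^J$ carries the standard inner product $\langle\cdot,\cdot\rangle$ and Euclidean norm. $\Gamma_0(X)$ is the set of proper lower semicontinuous convex functions $X\to\,]-\infty,+\infty]$; $\operatorname{dom} g=\{x: g(x)<+\infty\}$. A function $g$ is coercive if $g(x)\to+\infty$ as $\|x\|\to+\infty$. "$a_\gamma\uparrow a$ as $\gamma\downarrow0$" means that $a_\gamma$ is nondecreasing as $\gamma$ decreases to $0$ and converges to $a$. $f$ of Legendre type means essentially smooth and essentially strictly convex in the sense of Rockafellar; $U=\operatorname{int}\operatorname{dom}f\ne\varnothing$. The Bregman distance is $D_f(x,y)=f(x)-f(y)-\langle\nabla f(y),x-y\rangle$ if $y\in U$, and $D_f(x,y)=+\infty$ otherwise. Standing assumptions: (A1) $\nabla^2 f$ exists and is continuous on $U$; (A2) $D_f$ is convex on $X\times X$; (A3) for every $x\in U$, $D_f(x,\cdot)$ is strictly convex on $U$; (A4) for every $x\in U$, $D_f(x,\cdot)$ is coercive. The left and right Bregman--Moreau envelopes are $\overleftarrow{\operatorname{env}}_\theta^{\gamma}(y)=\inf_{x\in X}\big(\theta(x)+\frac1\gamma D_f(x,y)\big)$ and $\overrightarrow{\operatorname{env}}_\theta^{\gamma}(x)=\inf_{y\in X}\big(\theta(y)+\frac1\gamma D_f(x,y)\big)$. When $\theta(\cdot)+\frac1\gamma D_f(\cdot,v)$ is coercive for every $v\in U$, the left proximity operator $\overleftarrow{P}_{\gamma\theta}\colon U\to U$ sends $y$ to the unique minimizer over $x\in X$ of $\gamma\theta(x)+D_f(x,y)$.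 When $\theta(\cdot)+\frac1\gamma D_f(u,\cdot)$ is coercive for every $u\in U$, the right proximity operator $\overrightarrow{P}_{\gamma\theta}\colon U\to U$ sends $x$ to the unique minimizer over $y\in X$ of $\gamma\theta(y)+D_f(x,y)$. (These minimizers exist, are unique and lie in $U$.) If a coercivity condition holds for $\mu$, it holds for every $\gamma\in\,]0,\mu]$, so the operators are defined for all small $\gamma$.
   Formalization: The limit of θ at the left (right) proximity point is claimed only if y (x) lies in the closure of dom θ, and the limit (1/γ)D_f→0 only if y (x) lies in dom θ; as stated both fail, e.g. for f=½|·|², θ the indicator of {0}, x=y=1. *)

theory Defs
  imports "HOL-Analysis.Analysis"
begin

text \<open>
  Functions \<open>X \<rightarrow> ]-\<infinity>,+\<infinity>]\<close> are rendered as functions into \<^typ>\<open>ereal\<close>; that \<open>-\<infinity>\<close> is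
  not attained is part of \<open>proper_fun\<close>.
\<close>

definition edom :: "('a \<Rightarrow> ereal) \<Rightarrow> 'a set" where
  "edom g = {x. g x < \<infinity>}"

definition proper_fun :: "('a \<Rightarrow> ereal) \<Rightarrow> bool" where
  "proper_fun g \<longleftrightarrow> (\<forall>x. g x \<noteq> - \<infinity>) \<and> edom g \<noteq> {}"

definition lsc_fun :: "('a::topological_space \<Rightarrow> ereal) \<Rightarrow> bool" where
  "lsc_fun g \<longleftrightarrow> (\<forall>x. g x \<le> Liminf (at x) g)"

text \<open>
  The weights are taken in the open interval because \<^term>\<open>0 * \<infinity> = (0::ereal)\<close>. The two
  convexity notions below are meant for functions that do not take the value \<open>-\<infinity>\<close>
  (in \<^typ>\<open>ereal\<close>, \<open>\<infinity> + -\<infinity> = \<infinity>\<close>).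
\<close>

definition convex_fun :: "('a::real_vector \<Rightarrow> ereal) \<Rightarrow> bool" where
  "convex_fun g \<longleftrightarrow>
     (\<forall>x y. \<forall>t\<in>{0<..<1}.
        g ((1 - t) *\<^sub>R x + t *\<^sub>R y) \<le> ereal (1 - t) * g x + ereal t * g y)"

definition strictly_convex_fun_on :: "'a::real_vector set \<Rightarrow> ('a \<Rightarrow> ereal) \<Rightarrow> bool" where
  "strictly_convex_fun_on S g \<longleftrightarrow> convex S \<and>
     (\<forall>x\<in>S. \<forall>y\<in>S. \<forall>t\<in>{0<..<1}. x \<noteq> y \<longrightarrow>
        g ((1 - t) *\<^sub>R x + t *\<^sub>R y) < ereal (1 - t) * g x + ereal t * g y)"

definition Gamma0 :: "('a::real_normed_vector \<Rightarrow> ereal) set" where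
  "Gamma0 = {g. proper_fun g \<and> lsc_fun g \<and> convex_fun g}"

definition coercive_fun :: "('a::real_normed_vector \<Rightarrow> ereal) \<Rightarrow> bool" where
  "coercive_fun g \<longleftrightarrow> (g \<longlongrightarrow> \<infinity>) at_infinity"

text \<open>
  The gradient and the Hessian are only meaningful at interior points of the domain, where
  the real-valued function \<open>x \<mapsto> real_of_ereal (f x)\<close> agrees with \<open>f\<close> on a neighbourhood.
\<close>

definition grad :: "('a::euclidean_space \<Rightarrow> ereal) \<Rightarrow> 'a \<Rightarrow> 'a" where
  "grad f y = (THE d. GDERIV (\<lambda>x. real_of_ereal (f x)) y :> d)"

definition hessian :: "(real ^ 'n \<Rightarrow> ereal) \<Rightarrow> real ^ 'n \<Rightarrow> real ^ 'n ^ 'n" where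
  "hessian f y = jacobian (grad f) (at y)"

definition dom_subdiff :: "('a::real_inner \<Rightarrow> ereal) \<Rightarrow> 'a set" where
  "dom_subdiff f = {x. \<exists>u. \<forall>z. f x + ereal (u \<bullet> (z - x)) \<le> f z}"

text \<open>Essential smoothness and essential strict convexity in the sense of Rockafellar.\<close>

definition essentially_smooth :: "('a::euclidean_space \<Rightarrow> ereal) \<Rightarrow> bool" where
  "essentially_smooth f \<longleftrightarrow>
     interior (edom f) \<noteq> {} \<and>
     (\<forall>x\<in>interior (edom f). (\<lambda>z. real_of_ereal (f z)) differentiable (at x)) \<and>
     (\<forall>s z. (\<forall>n. s n \<in> interior (edom f)) \<and> s \<longlonglongrightarrow> z \<and> z \<in> frontier (interior (edom f))
        \<longrightarrow> filterlim (\<lambda>n. norm (grad f (s n))) at_top sequentially)"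

definition essentially_strictly_convex :: "('a::real_inner \<Rightarrow> ereal) \<Rightarrow> bool" where
  "essentially_strictly_convex f \<longleftrightarrow>
     (\<forall>C. convex C \<and> C \<subseteq> dom_subdiff f \<longrightarrow> strictly_convex_fun_on C f)"

definition legendre :: "('a::euclidean_space \<Rightarrow> ereal) \<Rightarrow> bool" where
  "legendre f \<longleftrightarrow> essentially_smooth f \<and> essentially_strictly_convex f"

definition bregman :: "('a::euclidean_space \<Rightarrow> ereal) \<Rightarrow> 'a \<Rightarrow> 'a \<Rightarrow> ereal" where
  "bregman f x y =
     (if y \<in> interior (edom f) then f x - f y - ereal (grad f y \<bullet> (x - y)) else \<infinity>)"

definition left_env ::
  "('a::euclidean_space \<Rightarrow> ereal) \<Rightarrow> ('a \<Rightarrow> ereal) \<Rightarrow> real \<Rightarrow> 'a \<Rightarrow> ereal" where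
  "left_env f \<theta> \<gamma> y = (INF x. \<theta> x + ereal (1 / \<gamma>) * bregman f x y)"

definition right_env ::
  "('a::euclidean_space \<Rightarrow> ereal) \<Rightarrow> ('a \<Rightarrow> ereal) \<Rightarrow> real \<Rightarrow> 'a \<Rightarrow> ereal" where
  "right_env f \<theta> \<gamma> x = (INF y. \<theta> y + ereal (1 / \<gamma>) * bregman f x y)"

text \<open>
  The proximity operators \<open>P\<^bsub>\<gamma>\<theta>\<^esub>\<close>: the minimizer over the whole space (not only over the interior of the domain), meaningful
  whenever it exists and is unique.
\<close>

definition left_prox ::
  "('a::euclidean_space \<Rightarrow> ereal) \<Rightarrow> ('a \<Rightarrow> ereal) \<Rightarrow> real \<Rightarrow> 'a \<Rightarrow> 'a" where
  "left_prox f \<theta> \<gamma> y =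
     (THE x. is_arg_min (\<lambda>x. ereal \<gamma> * \<theta> x + bregman f x y) (\<lambda>x. True) x)"

definition right_prox ::
  "('a::euclidean_space \<Rightarrow> ereal) \<Rightarrow> ('a \<Rightarrow> ereal) \<Rightarrow> real \<Rightarrow> 'a \<Rightarrow> 'a" where
  "right_prox f \<theta> \<gamma> x =
     (THE y. is_arg_min (\<lambda>y. ereal \<gamma> * \<theta> y + bregman f x y) (\<lambda>y. True) y)"

end

theory Submission
  imports Defs
begin

text \<open>
  Both parts are instances of one penalty argument: \<open>d\<close> is a nonnegative convex lsc function
  vanishing only at \<open>y\<close>, and \<open>\<theta> + d / \<gamma>\<close> has a unique minimizer for small \<open>\<gamma>\<close>. By convexity and
  compactness of spheres, \<open>d\<close> small forces nearness to \<open>y\<close>. Since \<open>\<theta> + d / \<mu>\<close> is bounded below,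
  any point where \<open>\<theta> + d / \<gamma>\<close> stays bounded as \<open>\<gamma> \<rightarrow> 0\<close> has \<open>d\<close> small, and lower semicontinuity
  of \<open>\<theta>\<close> at \<open>y\<close> gives the limits. To apply this to the Bregman distance one uses the estimate
  \<open>f v + \<langle>\<nabla>f v, z - v\<rangle> + \<epsilon> \<bar>\<nabla>f v\<bar> \<le> M\<close> for fixed \<open>z \<in> U\<close> and all \<open>v \<in> U\<close>: as the gradient blows up at
  the boundary of \<open>U\<close>, it yields both lower semicontinuity of \<open>D\<^sub>f(z, \<cdot>)\<close> across the boundary
  and the fact that left minimizers lie in \<open>U\<close>.
\<close>

section \<open>Lower semicontinuous functions\<close>

text \<open>At \<open>x\<close> itself the inequality is the premise, so punctured neighbourhoods
  may be replaced by full ones.\<close>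

lemma lsc_fun_eventually:
  "lsc_fun g \<longleftrightarrow> (\<forall>x c. c < g x \<longrightarrow> (\<forall>\<^sub>F z in nhds x. c < g z))"
  unfolding lsc_fun_def le_Liminf_iff eventually_nhds_conv_at by blast

text \<open>It suffices to split a level \<open>c\<close> below the sum into levels \<open>a\<close>
  and \<open>b\<close> below the summands such that exceeding both of them forces the sum above
  \<open>c\<close>.\<close>

lemma lsc_fun_add:
  assumes "lsc_fun g" "lsc_fun h" "\<And>x. g x \<noteq> -\<infinity>" "\<And>x. h x \<noteq> -\<infinity>"
  shows "lsc_fun (\<lambda>x. g x + h x)"
  unfolding lsc_fun_eventually
proof (intro allI impI)
  fix x c assume c: "c < g x + h x"
  have "\<exists>a b. a < g x \<and> b < h x \<and> (\<forall>s t. a < s \<longrightarrow> b < t \<longrightarrow> c < s + t)"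
  \<comment> \<open>If one summand is infinite, its level can be taken high enough to compensate any
    real level below the other. If both are finite, each level gives up half of the slack.\<close>
  proof (cases "g x = \<infinity> \<or> h x = \<infinity>")
    case True
    obtain C where C: "c \<le> ereal C"
      using c by (cases c) auto
    have *: "c < s + t" if "ereal u < s" "ereal v < t" "u + v \<ge> C" for s t u v
    proof -
      have "ereal (u + v) < s + t"
        using that(1,2) by (cases s; cases t) auto
      with C that(3) show ?thesis
        by (meson ereal_less_eq(3) le_less_trans order_trans)
    qed
    from True show ?thesis
    proof
      assume g: "g x = \<infinity>"
      obtain v where v: "ereal v < h x"
        using assms(4)[of x] by (metis MInfty_neq_ereal(1) ereal_bot linorder_not_less)
      with g show ?thesis
        by (intro exI[of _ "ereal (C - v)"] exI[of _ "ereal v"]) (auto intro: *)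
    next
      assume h: "h x = \<infinity>"
      obtain v where v: "ereal v < g x"
        using assms(3)[of x] by (metis MInfty_neq_ereal(1) ereal_bot linorder_not_less)
      with h show ?thesis
        by (intro exI[of _ "ereal v"] exI[of _ "ereal (C - v)"]) (auto intro: *)
    qed
  next
    case False
    then obtain p q where pq: "g x = ereal p" "h x = ereal q"
      using assms(3,4)[of x] by (cases "g x"; cases "h x") auto
    with c obtain C where C: "c < ereal C" "C < p + q"
      using ereal_dense2[OF c] by auto
    define e where "e = (p + q - C) / 2"
    have "c < s + t" if "ereal (p - e) < s" "ereal (q - e) < t" for s t
    proof -
      have "ereal C < s + t"
        using that by (cases s; cases t) (auto simp: e_def field_simps)
      with C show ?thesis by simp
    qed
    then show ?thesis
      using C pq by (intro exI[of _ "ereal (p - e)"] exI[of _ "ereal (q - e)"]) (auto simp: e_def)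
  qed
  then obtain a b where ab: "a < g x" "b < h x" "\<And>s t. a < s \<Longrightarrow> b < t \<Longrightarrow> c < s + t"
    by blast
  have "\<forall>\<^sub>F z in nhds x. a < g z" "\<forall>\<^sub>F z in nhds x. b < h z"
    using assms(1,2) ab(1,2) unfolding lsc_fun_eventually by blast+
  then show "\<forall>\<^sub>F z in nhds x. c < g z + h z"
    by eventually_elim (rule ab(3))
qed

lemma lsc_fun_cmult:
  assumes "lsc_fun g" "0 < k"
  shows "lsc_fun (\<lambda>x. ereal k * g x)"
proof -
  have "c < ereal k * t \<longleftrightarrow> c / ereal k < t" for c t
    using assms(2) by (simp add: ereal_divide_less_iff mult.commute)
  with assms(1) show ?thesis
    unfolding lsc_fun_eventually by simp
qed

text \<open>Without a minimum the open sets \<open>V z\<close> would cover \<open>K\<close>. In a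
  finite subcover, a centre of least value would lie in some \<open>V w\<close> and hence exceed the
  value of another centre.\<close>

lemma lsc_fun_attains_inf:
  assumes g: "lsc_fun g" and K: "compact K" "K \<noteq> {}"
  shows "\<exists>x\<in>K. \<forall>z\<in>K. g x \<le> g z"
proof (rule ccontr)
  assume "\<not> ?thesis"
  then have lower: "\<forall>x\<in>K. \<exists>z\<in>K. g z < g x"
    by (metis linorder_not_le)
  define V where "V z = {x. g z < g x}" for z
  have "open (V z)" for z
    unfolding open_subopen[of "V z"]
  proof
    fix x assume "x \<in> V z"
    then have "\<forall>\<^sub>F w in nhds x. g z < g w"
      using g by (simp add: V_def lsc_fun_eventually)
    then show "\<exists>T. open T \<and> x \<in> T \<and> T \<subseteq> V z"
      by (auto simp: eventually_nhds V_def)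
  qed
  moreover have "K \<subseteq> (\<Union>z\<in>K. V z)"
    using lower by (auto simp: V_def)
  ultimately obtain D where D: "D \<subseteq> K" "finite D" "K \<subseteq> (\<Union>z\<in>D. V z)"
    using K(1) by (metis compactE_image)
  with K(2) have "D \<noteq> {}" by auto
  with D(2) have "Min (g ` D) \<in> g ` D" "\<And>w. w \<in> D \<Longrightarrow> Min (g ` D) \<le> g w"
    by auto
  then obtain z where z: "z \<in> D" "\<And>w. w \<in> D \<Longrightarrow> g z \<le> g w"
    by auto
  with D(1,3) obtain w where "w \<in> D" "g w < g z"
    by (auto simp: V_def)
  with z(2) show False by force
qed

text \<open>Outside a large ball the values exceed a finite value \<open>h w\<close>, so a minimum
  over the ball is global. If \<open>h\<close> is infinite everywhere, any point serves.\<close>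

lemma coercive_lsc_fun_attains_inf:
  fixes h :: "'a::{real_normed_vector, heine_borel} \<Rightarrow> ereal"
  assumes "lsc_fun h" "coercive_fun h"
  shows "\<exists>x. \<forall>z. h x \<le> h z"
proof (cases "\<exists>z. h z < \<infinity>")
  case True
  then obtain w where w: "h w < \<infinity>" by blast
  then have "\<forall>\<^sub>F z in at_infinity. h w < h z"
    using assms(2) unfolding coercive_fun_def by (rule order_tendstoD(1)[rotated])
  then obtain b where b: "\<And>z. b \<le> norm z \<Longrightarrow> h w < h z"
    unfolding eventually_at_infinity by blast
  \<comment> \<open>The radius is at least \<open>norm w\<close>, so that \<open>w\<close> itself
    competes in the ball.\<close>
  define B where "B = max b (norm w)"
  obtain x where x: "\<And>z. z \<in> cball 0 B \<Longrightarrow> h x \<le> h z"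
    using lsc_fun_attains_inf[OF assms(1), of "cball 0 B"] by (force simp: B_def)
  have "h x \<le> h z" for z
  proof (cases "norm z \<le> B")
    case False
    have "h x \<le> h w" by (rule x) (simp add: B_def)
    with b[of z] False show ?thesis by (force simp: B_def)
  qed (use x in auto)
  then show ?thesis by blast
qed (auto simp: not_less)

text \<open>The minimum of \<open>d\<close> over the sphere of radius \<open>r\<close> is positive.
  Since \<open>d y = 0\<close>, convexity along the segment from \<open>y\<close> to a point
  \<open>x\<close> beyond the sphere shows that \<open>d x\<close> is no smaller than
  \<open>d\<close> at the crossing point \<open>p\<close>.\<close>

lemma convex_lsc_fun_small_imp_near:
  fixes d :: "'a::euclidean_space \<Rightarrow> ereal"
  assumes "lsc_fun d" "convex_fun d" "d y = 0" "\<And>x. x \<noteq> y \<Longrightarrow> 0 < d x" "0 < r"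
  obtains e where "0 < e" "\<And>x. d x < ereal e \<Longrightarrow> dist x y < r"
proof -
  have "sphere y r \<noteq> {}" "y \<notin> sphere y r"
    using \<open>0 < r\<close> by auto
  then obtain s where s: "s \<noteq> y" "\<And>x. x \<in> sphere y r \<Longrightarrow> d s \<le> d x"
    using lsc_fun_attains_inf[OF assms(1), of "sphere y r"] by force
  obtain e where e: "0 < e" "ereal e < d s"
    using ereal_dense2[OF assms(4)[OF s(1)]] by auto
  have "ereal e \<le> d x" if x: "r \<le> dist x y" for x
  proof (cases "r = dist x y")
    case True
    then have "x \<in> sphere y r" by (simp add: dist_commute)
    with s(2) e(2) show ?thesis by force
  next
    case False
    define t where "t = r / dist x y"
    have "0 < dist x y" using x \<open>0 < r\<close> by linarith
    have t: "0 < t" "t < 1" "t * dist x y = r"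
      using \<open>0 < dist x y\<close> False x \<open>0 < r\<close> by (auto simp: t_def divide_less_eq simp del: zero_less_dist_iff)
    define p where "p = (1 - t) *\<^sub>R y + t *\<^sub>R x"
    have "p - y = t *\<^sub>R (x - y)"
      by (simp add: p_def algebra_simps)
    then have "p \<in> sphere y r"
      using t by (simp add: dist_norm norm_minus_commute)
    then have "ereal e < d p" using s(2) e(2) by force
    also have "d p \<le> ereal (1 - t) * d y + ereal t * d x"
      using assms(2) t unfolding convex_fun_def p_def by simp
    also have "\<dots> = ereal t * d x" by (simp add: assms(3))
    finally have *: "ereal e < ereal t * d x" .
    show ?thesis
    proof (cases "d x")
      case (real b)
      with * have "e < t * b" by simp
      moreover have "0 < b" using calculation e(1) t(1)
        by (meson less_trans zero_less_mult_pos)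
      then have "t * b \<le> b" using t(2) by simp
      ultimately show ?thesis using real by simp
    qed (use * t in auto)
  qed
  with e(1) that show thesis by (metis linorder_not_le)
qed

section \<open>Vanishing penalties\<close>

text \<open>\<open>d\<close> stands for \<open>bregman f\<close> with either its second or its first
  argument fixed. The point \<open>z\<^sub>0\<close> keeps all penalized infima below infinity.
  Uniqueness of minimizers is assumed because the two sides obtain it differently.\<close>

locale penalty =
  fixes \<theta> d :: "'a::euclidean_space \<Rightarrow> ereal" and y z\<^sub>0 :: 'a and \<mu> :: real
  assumes theta_not_MInf: "\<theta> x \<noteq> -\<infinity>"
    and theta_lsc: "lsc_fun \<theta>"
    and d_nonneg: "0 \<le> d x"
    and d_eq_0_iff: "d x = 0 \<longleftrightarrow> x = y"
    and d_lsc: "lsc_fun d"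
    and d_convex: "convex_fun d"
    and d_tendsto: "(d \<longlongrightarrow> 0) (nhds y)"
    and z0: "\<theta> z\<^sub>0 < \<infinity>" "d z\<^sub>0 < \<infinity>"
    and mu_pos: "0 < \<mu>"
    and coercive: "coercive_fun (\<lambda>z. \<theta> z + ereal (1 / \<mu>) * d z)"
    and minimizer_unique:
      "\<lbrakk>0 < \<gamma>; \<gamma> \<le> \<mu>; is_arg_min (\<lambda>x. ereal \<gamma> * \<theta> x + d x) (\<lambda>x. True) u;
        is_arg_min (\<lambda>x. ereal \<gamma> * \<theta> x + d x) (\<lambda>x. True) w\<rbrakk> \<Longrightarrow> u = w"
begin

definition env :: "real \<Rightarrow> ereal" where
  "env \<gamma> = (INF x. \<theta> x + ereal (1 / \<gamma>) * d x)"

text \<open>The objective is scaled as in \<open>left_prox\<close> and \<open>right_prox\<close>, so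
  that instances agree with them by unfolding; \<open>is_arg_min_iff\<close> passes to the scaling
  of \<open>env\<close>.\<close>

definition prox :: "real \<Rightarrow> 'a" where
  "prox \<gamma> = (THE x. is_arg_min (\<lambda>x. ereal \<gamma> * \<theta> x + d x) (\<lambda>x. True) x)"

lemma d_y [simp]: "d y = 0"
  by (simp add: d_eq_0_iff)

lemma d_not_MInf: "d x \<noteq> -\<infinity>"
  using d_nonneg[of x] by auto

lemma small_imp_near:
  assumes "0 < r"
  obtains e where "0 < e" "\<And>x. d x < ereal e \<Longrightarrow> dist x y < r"
proof (rule convex_lsc_fun_small_imp_near[OF d_lsc d_convex d_y _ assms])
  show "0 < d x" if "x \<noteq> y" for x
    using d_nonneg[of x] d_eq_0_iff[of x] that by (simp add: order_le_less)
qed (rule that)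

lemma penalized_mono:
  assumes "0 < \<gamma>" "\<gamma> \<le> \<gamma>'"
  shows "\<theta> x + ereal (1 / \<gamma>') * d x \<le> \<theta> x + ereal (1 / \<gamma>) * d x"
  using assms by (intro add_left_mono ereal_mult_right_mono d_nonneg) (simp add: frac_le)

text \<open>Coercivity at \<open>\<mu>\<close> passes to every smaller \<open>\<gamma>\<close>,
  since the penalty only grows.\<close>

lemma penalized_attains_inf:
  assumes "0 < \<gamma>" "\<gamma> \<le> \<mu>"
  shows "\<exists>x. \<forall>z. \<theta> x + ereal (1 / \<gamma>) * d x \<le> \<theta> z + ereal (1 / \<gamma>) * d z"
proof (rule coercive_lsc_fun_attains_inf)
  show "lsc_fun (\<lambda>x. \<theta> x + ereal (1 / \<gamma>) * d x)"
    using d_not_MInf assms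
    by (intro lsc_fun_add lsc_fun_cmult theta_lsc d_lsc theta_not_MInf) (auto simp: ereal_mult_eq_MInfty)
  show "coercive_fun (\<lambda>x. \<theta> x + ereal (1 / \<gamma>) * d x)"
    using coercive penalized_mono[OF assms] unfolding coercive_fun_def
    by (auto simp: tendsto_PInfty intro: eventually_mono less_le_trans)
qed

lemma is_arg_min_iff:
  assumes "0 < \<gamma>"
  shows "is_arg_min (\<lambda>x. ereal \<gamma> * \<theta> x + d x) (\<lambda>x. True) u \<longleftrightarrow>
    (\<forall>z. \<theta> u + ereal (1 / \<gamma>) * d u \<le> \<theta> z + ereal (1 / \<gamma>) * d z)"
proof -
  have "ereal \<gamma> * \<theta> x + d x = ereal \<gamma> * (\<theta> x + ereal (1 / \<gamma>) * d x)" for x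
    using assms by (simp add: ereal_pos_distrib mult.assoc[symmetric])
  then show ?thesis
    using assms by (simp add: is_arg_min_linorder ereal_mult_le_mult_iff)
qed

text \<open>Existence and uniqueness of the minimizer make the description in \<open>prox\<close>
  denote it.\<close>

lemma prox_le:
  assumes "0 < \<gamma>" "\<gamma> \<le> \<mu>"
  shows "\<theta> (prox \<gamma>) + ereal (1 / \<gamma>) * d (prox \<gamma>) \<le> \<theta> z + ereal (1 / \<gamma>) * d z"
proof -
  obtain u where "is_arg_min (\<lambda>x. ereal \<gamma> * \<theta> x + d x) (\<lambda>x. True) u"
    using penalized_attains_inf[OF assms] is_arg_min_iff[OF assms(1)] by blast
  then have "is_arg_min (\<lambda>x. ereal \<gamma> * \<theta> x + d x) (\<lambda>x. True) (prox \<gamma>)"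
    unfolding prox_def using minimizer_unique[OF assms] by (metis (no_types, lifting) theI')
  then show ?thesis
    using is_arg_min_iff[OF assms(1)] by blast
qed

lemma prox_finite:
  assumes "0 < \<gamma>" "\<gamma> \<le> \<mu>"
  obtains a b where "\<theta> (prox \<gamma>) = ereal a" "d (prox \<gamma>) = ereal b" "0 \<le> b"
proof -
  have "\<theta> (prox \<gamma>) + ereal (1 / \<gamma>) * d (prox \<gamma>) < \<infinity>"
    using prox_le[OF assms, of z\<^sub>0] z0 theta_not_MInf[of z\<^sub>0] d_not_MInf[of z\<^sub>0]
    by (cases "\<theta> z\<^sub>0"; cases "d z\<^sub>0") (auto elim: le_less_trans)
  then show thesis
    using that assms(1) theta_not_MInf[of "prox \<gamma>"] d_nonneg[of "prox \<gamma>"]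
    by (cases "\<theta> (prox \<gamma>)"; cases "d (prox \<gamma>)") auto
qed

text \<open>The minimal value for \<open>\<mu>\<close> serves as \<open>m\<close>. In the limit
  arguments this bound controls how negative \<open>\<theta>\<close> can be in terms of
  \<open>d\<close>.\<close>

lemma penalized_bounded_below:
  obtains m where "\<And>z. ereal m \<le> \<theta> z + ereal (1 / \<mu>) * d z"
proof -
  obtain a b where "\<theta> (prox \<mu>) = ereal a" "d (prox \<mu>) = ereal b"
    using prox_finite[of \<mu>] mu_pos by blast
  with prox_le[of \<mu>] mu_pos that[of "a + b / \<mu>"] show thesis by simp
qed

lemma prox_real_le:
  assumes "0 < \<gamma>" "\<gamma> \<le> \<mu>" "\<theta> (prox \<gamma>) = ereal a" "d (prox \<gamma>) = ereal b"
    "\<theta> z = ereal a'" "d z = ereal b'"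
  shows "a + b / \<gamma> \<le> a' + b' / \<gamma>"
  using prox_le[OF assms(1,2), of z] assms(3-) by simp

section \<open>Monotonicity and limit of the envelope\<close>

lemma antimono_env: "antimono_on {0<..} env"
  unfolding env_def
  by (rule monotone_onI) (simp add: INF_mono' penalized_mono)

lemma env_le: "env \<gamma> \<le> \<theta> y"
  unfolding env_def by (rule INF_lower2[of y]) auto

lemma theta_lower_near:
  assumes "c < \<theta> y"
  obtains r where "0 < r" "\<And>x. dist x y < r \<Longrightarrow> c < \<theta> x"
  using theta_lsc assms unfolding lsc_fun_eventually eventually_nhds_metric by metis

lemma eventually_at_right_0: "0 < (b::real) \<Longrightarrow> \<forall>\<^sub>F \<gamma> in at_right 0. 0 < \<gamma> \<and> \<gamma> \<le> b"
  by (rule eventually_mono[OF eventually_at_right_real[of 0 b]]) auto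

text \<open>Testing at \<open>y\<close> bounds the envelope by \<open>\<theta> y\<close>.
  Conversely, if the penalized value at \<open>x\<close> were below \<open>c\<close> for small
  \<open>\<gamma>\<close>, comparison with the lower bound \<open>m\<close> would force
  \<open>d x\<close> to be small, hence \<open>x\<close> near \<open>y\<close> and
  \<open>\<theta> x\<close> above \<open>c\<close>. Using a real level \<open>c\<close> covers
  infinite \<open>\<theta> y\<close> too.\<close>

lemma env_tendsto: "(env \<longlongrightarrow> \<theta> y) (at_right 0)"
proof (rule order_tendstoI)
  fix a assume "\<theta> y < a"
  then show "\<forall>\<^sub>F \<gamma> in at_right 0. env \<gamma> < a"
    by (intro always_eventually allI le_less_trans[OF env_le])
next
  fix a assume a: "a < \<theta> y"
  obtain c where c: "a < ereal c" "ereal c < \<theta> y"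
    using ereal_dense2[OF a] by blast
  obtain r where r: "0 < r" "\<And>x. dist x y < r \<Longrightarrow> ereal c < \<theta> x"
    using theta_lower_near[OF c(2)] by blast
  obtain e where e: "0 < e" "\<And>x. d x < ereal e \<Longrightarrow> dist x y < r"
    using small_imp_near[OF r(1)] by blast
  obtain m where m: "\<And>z. ereal m \<le> \<theta> z + ereal (1 / \<mu>) * d z"
    using penalized_bounded_below by blast
  \<comment> \<open>For \<open>\<gamma> \<le> 1 / B\<close> the difference
    \<open>1 / \<gamma> - 1 / \<mu>\<close> is at least \<open>(\<bar>c - m\<bar> + 1) / e\<close>,
    which yields \<open>t < e\<close> below. The added 1 keeps the factor to be cancelled
    positive.\<close>
  define B where "B = (\<bar>c - m\<bar> + 1) / e + 1 / \<mu>"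
  have B: "0 < B" using e(1) mu_pos by (simp add: B_def add_pos_pos)
  have "ereal c \<le> env \<gamma>" if \<gamma>: "0 < \<gamma>" "\<gamma> \<le> 1 / B" for \<gamma>
    unfolding env_def
  proof (rule INF_greatest, rule ccontr)
    fix x assume "\<not> ereal c \<le> \<theta> x + ereal (1 / \<gamma>) * d x"
    then obtain s t where st: "\<theta> x = ereal s" "d x = ereal t" "s + t / \<gamma> < c"
      using theta_not_MInf[of x] d_not_MInf[of x] \<gamma>(1)
      by (cases "\<theta> x"; cases "d x") auto
    have t: "0 \<le> t" using d_nonneg[of x] st by simp
    have "m \<le> s + t / \<mu>" using m[of x] st by simp
    with st(3) have "t * (1 / \<gamma> - 1 / \<mu>) < c - m"
      by (simp add: field_simps)
    moreover have "B \<le> 1 / \<gamma>" using \<gamma> B by (simp add: field_simps)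
    then have "(\<bar>c - m\<bar> + 1) / e \<le> 1 / \<gamma> - 1 / \<mu>" by (simp add: B_def)
    then have "t * ((\<bar>c - m\<bar> + 1) / e) \<le> t * (1 / \<gamma> - 1 / \<mu>)"
      using t by (rule mult_left_mono)
    ultimately have "t * ((\<bar>c - m\<bar> + 1) / e) < \<bar>c - m\<bar> + 1" by linarith
    then have "t * (\<bar>c - m\<bar> + 1) < e * (\<bar>c - m\<bar> + 1)"
      using e(1) by (simp add: divide_less_eq mult.commute)
    then have "t < e" by (rule mult_right_less_imp_less) simp
    with e(2)[of x] r(2)[of x] st(1,2) have "c < s" by simp
    moreover have "0 \<le> t / \<gamma>" using t \<gamma>(1) by simp
    ultimately show False using st(3) by simp
  qed
  then have "a < env \<gamma>" if "0 < \<gamma>" "\<gamma> \<le> 1 / B" for \<gamma>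
    using c(1) that less_le_trans by blast
  then show "\<forall>\<^sub>F \<gamma> in at_right 0. a < env \<gamma>"
    using eventually_at_right_0[of "1 / B"] B by (auto elim!: eventually_mono)
qed

section \<open>Monotonicity and limits along the proximal points\<close>

lemma antimono_theta_prox: "antimono_on {0<..\<mu>} (\<lambda>\<gamma>. \<theta> (prox \<gamma>))"
proof (rule monotone_onI)
  fix \<gamma> \<gamma>' assume "\<gamma> \<in> {0<..\<mu>}" "\<gamma>' \<in> {0<..\<mu>}" "\<gamma> \<le> \<gamma>'"
  then have *: "0 < \<gamma>" "\<gamma> \<le> \<mu>" "0 < \<gamma>'" "\<gamma>' \<le> \<mu>" "\<gamma> \<le> \<gamma>'" by auto
  show "\<theta> (prox \<gamma>') \<le> \<theta> (prox \<gamma>)"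
  proof (cases "\<gamma> = \<gamma>'")
    case False
    obtain a b where ab: "\<theta> (prox \<gamma>) = ereal a" "d (prox \<gamma>) = ereal b"
      using prox_finite *(1,2) by blast
    obtain a' b' where ab': "\<theta> (prox \<gamma>') = ereal a'" "d (prox \<gamma>') = ereal b'"
      using prox_finite *(3,4) by blast
    \<comment> \<open>Each proximal point is tested in the minimality of the other. Adding the two
      inequalities cancels the values of \<open>\<theta>\<close> and orders those of
      \<open>d\<close>; the second inequality then orders the values of
      \<open>\<theta>\<close>.\<close>
    have 1: "a + b / \<gamma> \<le> a' + b' / \<gamma>" "a' + b' / \<gamma>' \<le> a + b / \<gamma>'"
      by (rule prox_real_le[OF *(1,2) ab ab'], rule prox_real_le[OF *(3,4) ab' ab])
    then have "(b - b') * (1 / \<gamma> - 1 / \<gamma>') \<le> 0"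
      by (simp add: algebra_simps diff_divide_distrib)
    moreover have "1 / \<gamma>' < 1 / \<gamma>"
      using * False by (intro divide_strict_left_mono) auto
    ultimately have "b \<le> b'" by (simp add: mult_le_0_iff)
    then have "b / \<gamma>' \<le> b' / \<gamma>'" using * by (simp add: divide_right_mono)
    with 1(2) ab ab' show ?thesis by simp
  qed simp
qed

text \<open>As \<open>\<theta> y\<close> may be infinite, the proximal point is compared not with
  \<open>y\<close> but with a point \<open>z\<close> of the domain so close to \<open>y\<close> that
  \<open>d z\<close> is small. Multiplying by \<open>\<gamma>\<close> makes the contribution of
  \<open>\<theta>\<close> vanish in the limit.\<close>

lemma d_prox_tendsto:
  assumes "y \<in> closure (edom \<theta>)"
  shows "((\<lambda>\<gamma>. d (prox \<gamma>)) \<longlongrightarrow> 0) (at_right 0)"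
proof (rule order_tendstoI)
  fix a :: ereal assume "a < 0"
  then show "\<forall>\<^sub>F \<gamma> in at_right 0. a < d (prox \<gamma>)"
    by (intro always_eventually allI less_le_trans[OF _ d_nonneg])
next
  fix a :: ereal assume "0 < a"
  from ereal_dense2[OF this] obtain e where e: "0 < e" "ereal e < a"
    by auto
  have "\<forall>\<^sub>F z in nhds y. d z < ereal (e / 4)"
    using d_tendsto e(1) by (intro order_tendstoD(2)) auto
  then obtain S where S: "open S" "y \<in> S" "\<And>z. z \<in> S \<Longrightarrow> d z < ereal (e / 4)"
    unfolding eventually_nhds by blast
  with assms obtain z where z: "z \<in> edom \<theta>" "d z < ereal (e / 4)"
    by (metis IntE IntI closure_iff_nhds_not_empty ex_in_conv subset_refl)
  then obtain s t where st: "\<theta> z = ereal s" "d z = ereal t" "t < e / 4"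
    using theta_not_MInf[of z] d_not_MInf[of z]
    by (cases "\<theta> z"; cases "d z") (auto simp: edom_def)
  obtain m where m: "\<And>z. ereal m \<le> \<theta> z + ereal (1 / \<mu>) * d z"
    using penalized_bounded_below by blast
  define w where "w = \<bar>s - m\<bar> + 1"
  have w: "0 < w" by (simp add: w_def add_nonneg_pos)
  \<comment> \<open>The bound \<open>\<mu> / 2\<close> lets half of \<open>q\<close> absorb the
    penalty in the lower bound \<open>m\<close>; the bound \<open>e / (4 * w)\<close> makes
    \<open>\<gamma> * (s - m)\<close> at most \<open>e / 4\<close>. Together with
    \<open>t < e / 4\<close> this gives \<open>q / 2 < e / 2\<close>.\<close>
  define K where "K = min (\<mu> / 2) (e / (4 * w))"
  have K: "0 < K"
    using e(1) mu_pos w by (simp add: K_def)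
  have "d (prox \<gamma>) < a" if \<gamma>: "0 < \<gamma>" "\<gamma> \<le> K" for \<gamma>
  proof -
    have \<gamma>\<mu>: "\<gamma> \<le> \<mu> / 2" "\<gamma> \<le> \<mu>" using \<gamma> mu_pos by (auto simp: K_def)
    obtain p q where pq: "\<theta> (prox \<gamma>) = ereal p" "d (prox \<gamma>) = ereal q" "0 \<le> q"
      using prox_finite \<gamma>(1) \<gamma>\<mu>(2) by blast
    have "p + q / \<gamma> \<le> s + t / \<gamma>"
      using prox_real_le \<gamma>(1) \<gamma>\<mu>(2) pq st by blast
    then have "\<gamma> * (p + q / \<gamma>) \<le> \<gamma> * (s + t / \<gamma>)" using \<gamma>(1) by (intro mult_left_mono) auto
    then have 1: "\<gamma> * p + q \<le> \<gamma> * s + t" using \<gamma>(1) by (simp add: distrib_left)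
    have "m \<le> p + q / \<mu>" using m[of "prox \<gamma>"] pq by simp
    then have "\<gamma> * m \<le> \<gamma> * (p + q / \<mu>)" using \<gamma>(1) by simp
    then have 2: "\<gamma> * m \<le> \<gamma> * p + (\<gamma> / \<mu>) * q" by (simp add: algebra_simps)
    have "(\<gamma> / \<mu>) * q \<le> (1 / 2) * q"
      using \<gamma>\<mu>(1) mu_pos pq(3) by (intro mult_right_mono) (auto simp: field_simps)
    with 1 2 have "q / 2 \<le> \<gamma> * (s - m) + t" unfolding right_diff_distrib by linarith
    also have "\<gamma> * (s - m) \<le> \<gamma> * w"
      using \<gamma>(1) by (intro mult_left_mono) (auto simp: w_def)
    also have "\<dots> \<le> e / (4 * w) * w"
      using \<gamma>(2) w by (intro mult_right_mono) (auto simp: K_def)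
    also have "\<dots> = e / 4" using w by (simp add: field_simps)
    finally have "q < e" using st(3) by simp
    with pq(2) have "d (prox \<gamma>) < ereal e" by simp
    then show ?thesis using e(2) by (rule less_trans)
  qed
  then show "\<forall>\<^sub>F \<gamma> in at_right 0. d (prox \<gamma>) < a"
    using eventually_at_right_0[OF K] by (auto elim!: eventually_mono)
qed

lemma theta_prox_le:
  assumes "0 < \<gamma>" "\<gamma> \<le> \<mu>"
  shows "\<theta> (prox \<gamma>) \<le> \<theta> y"
proof -
  have "\<theta> (prox \<gamma>) \<le> \<theta> (prox \<gamma>) + ereal (1 / \<gamma>) * d (prox \<gamma>)"
    using d_nonneg[of "prox \<gamma>"] assms by (simp add: ereal_le_add_self)
  also have "\<dots> \<le> \<theta> y" using prox_le[OF assms, of y] by simp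
  finally show ?thesis .
qed

text \<open>The values never exceed \<open>\<theta> y\<close>, and since the proximal points
  approach \<open>y\<close>, lower semicontinuity bounds them from below.\<close>

lemma theta_prox_tendsto:
  assumes "y \<in> closure (edom \<theta>)"
  shows "((\<lambda>\<gamma>. \<theta> (prox \<gamma>)) \<longlongrightarrow> \<theta> y) (at_right 0)"
proof (rule order_tendstoI)
  fix a assume "\<theta> y < a"
  then show "\<forall>\<^sub>F \<gamma> in at_right 0. \<theta> (prox \<gamma>) < a"
    by (intro eventually_mono[OF eventually_at_right_0[OF mu_pos]] le_less_trans[OF theta_prox_le]) auto
next
  fix a assume "a < \<theta> y"
  then obtain r where r: "0 < r" "\<And>x. dist x y < r \<Longrightarrow> a < \<theta> x"
    using theta_lower_near by blast
  obtain e where e: "0 < e" "\<And>x. d x < ereal e \<Longrightarrow> dist x y < r"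
    using small_imp_near[OF r(1)] by blast
  have "\<forall>\<^sub>F \<gamma> in at_right 0. d (prox \<gamma>) < ereal e"
    using d_prox_tendsto[OF assms] e(1) by (intro order_tendstoD(2)) auto
  then show "\<forall>\<^sub>F \<gamma> in at_right 0. a < \<theta> (prox \<gamma>)"
    by eventually_elim (use r e in blast)
qed

text \<open>Testing minimality at \<open>y\<close> squeezes the scaled penalty between 0 and
  \<open>\<theta> y - \<theta> (prox \<gamma>)\<close>; finiteness of \<open>\<theta> y\<close>
  makes this difference tend to 0.\<close>

lemma d_prox_over_tendsto:
  assumes "y \<in> edom \<theta>"
  shows "((\<lambda>\<gamma>. ereal (1 / \<gamma>) * d (prox \<gamma>)) \<longlongrightarrow> 0) (at_right 0)"
proof -
  obtain s where s: "\<theta> y = ereal s"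
    using assms theta_not_MInf[of y] by (cases "\<theta> y") (auto simp: edom_def)
  have "((\<lambda>\<gamma>. \<theta> y - \<theta> (prox \<gamma>)) \<longlongrightarrow> \<theta> y - \<theta> y) (at_right 0)"
    using s assms closure_subset
    by (intro tendsto_diff_ereal_general tendsto_const theta_prox_tendsto) auto
  then have upper: "((\<lambda>\<gamma>. \<theta> y - \<theta> (prox \<gamma>)) \<longlongrightarrow> 0) (at_right 0)"
    by (simp add: s zero_ereal_def)
  have le: "\<forall>\<^sub>F \<gamma> in at_right 0. ereal (1 / \<gamma>) * d (prox \<gamma>) \<le> \<theta> y - \<theta> (prox \<gamma>)"
    using eventually_at_right_0[OF mu_pos]
  proof eventually_elim
    fix \<gamma> assume \<gamma>: "0 < \<gamma> \<and> \<gamma> \<le> \<mu>"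
    obtain a b where ab: "\<theta> (prox \<gamma>) = ereal a" "d (prox \<gamma>) = ereal b"
      using prox_finite \<gamma> by blast
    have "a + b / \<gamma> \<le> s + 0 / \<gamma>"
      using prox_real_le[of \<gamma> a b y s 0] \<gamma> ab s by (auto simp: zero_ereal_def)
    then show "ereal (1 / \<gamma>) * d (prox \<gamma>) \<le> \<theta> y - \<theta> (prox \<gamma>)"
      by (simp add: ab s)
  qed
  have ge: "\<forall>\<^sub>F \<gamma> in at_right 0. 0 \<le> ereal (1 / \<gamma>) * d (prox \<gamma>)"
    using eventually_at_right_0[OF mu_pos] d_nonneg by (auto elim!: eventually_mono)
  show ?thesis
    by (rule tendsto_sandwich[OF ge le tendsto_const upper])
qed

end

section \<open>Convex functions and uniqueness of minimizers\<close>

lemma convex_funD: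
  "convex_fun g \<Longrightarrow> 0 < t \<Longrightarrow> t < 1 \<Longrightarrow>
    g ((1 - t) *\<^sub>R x + t *\<^sub>R y) \<le> ereal (1 - t) * g x + ereal t * g y"
  by (simp add: convex_fun_def)

lemma convex_edom:
  assumes "convex_fun g" "\<And>x. g x \<noteq> -\<infinity>"
  shows "convex (edom g)"
  unfolding convex_alt
proof (intro ballI allI impI)
  fix x y and t :: real
  assume *: "x \<in> edom g" "y \<in> edom g" "0 \<le> t \<and> t \<le> 1"
  show "(1 - t) *\<^sub>R x + t *\<^sub>R y \<in> edom g"
  proof (cases "t = 0 \<or> t = 1")
    case False
    with * have "g ((1 - t) *\<^sub>R x + t *\<^sub>R y) \<le> ereal (1 - t) * g x + ereal t * g y"
      by (intro convex_funD[OF assms(1)]) auto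
    also have "\<dots> < \<infinity>"
      using * assms(2)[of x] assms(2)[of y] by (cases "g x"; cases "g y") (auto simp: edom_def)
    finally show ?thesis by (simp add: edom_def)
  qed (use * in auto)
qed

lemma strictly_convex_fun_onD:
  "strictly_convex_fun_on S g \<Longrightarrow> x \<in> S \<Longrightarrow> y \<in> S \<Longrightarrow> x \<noteq> y \<Longrightarrow> 0 < t \<Longrightarrow> t < 1 \<Longrightarrow>
    g ((1 - t) *\<^sub>R x + t *\<^sub>R y) < ereal (1 - t) * g x + ereal t * g y"
  by (simp add: strictly_convex_fun_on_def)

text \<open>The midpoint of two distinct minimizers would have a smaller value. The point
  \<open>z\<close> ensures that minimal values are finite, so that the strict inequality survives
  adding \<open>\<theta>\<close>.\<close>

lemma strictly_convex_minimizer_unique: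
  assumes \<theta>: "convex_fun \<theta>" "\<And>x. \<theta> x \<noteq> -\<infinity>"
    and d: "strictly_convex_fun_on S d" "\<And>x. x \<in> S \<Longrightarrow> \<bar>d x\<bar> \<noteq> \<infinity>"
    and z: "z \<in> S" "\<theta> z < \<infinity>" and \<gamma>: "0 < \<gamma>"
    and u: "u \<in> S" "is_arg_min (\<lambda>x. ereal \<gamma> * \<theta> x + d x) (\<lambda>x. True) u"
    and w: "w \<in> S" "is_arg_min (\<lambda>x. ereal \<gamma> * \<theta> x + d x) (\<lambda>x. True) w"
  shows "u = w"
proof (rule ccontr)
  assume "u \<noteq> w"
  have fin: "\<exists>a b. \<theta> v = ereal a \<and> d v = ereal b"
    if v: "v \<in> S" "is_arg_min (\<lambda>x. ereal \<gamma> * \<theta> x + d x) (\<lambda>x. True) v" for v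
  proof -
    have "ereal \<gamma> * \<theta> v + d v \<le> ereal \<gamma> * \<theta> z + d z"
      using v(2) by (simp add: is_arg_min_linorder)
    then show ?thesis
      using \<theta>(2)[of v] \<theta>(2)[of z] d(2)[OF v(1)] d(2)[OF z(1)] z(2) \<gamma>
      by (cases "\<theta> v"; cases "d v"; cases "\<theta> z"; cases "d z") auto
  qed
  obtain a b where ab: "\<theta> u = ereal a" "d u = ereal b" using fin[OF u] by blast
  obtain a' b' where ab': "\<theta> w = ereal a'" "d w = ereal b'" using fin[OF w] by blast
  define p where "p = (1 - 1/2) *\<^sub>R u + (1/2::real) *\<^sub>R w"
  have "p \<in> S"
    using d(1) u(1) w(1) unfolding p_def strictly_convex_fun_on_def by (intro convexD_alt) auto
  then obtain q where q: "d p = ereal q" using d(2)[of p] by (cases "d p") auto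
  have "\<theta> p \<le> ereal (1 - 1/2) * \<theta> u + ereal (1/2) * \<theta> w"
    unfolding p_def by (rule convex_funD[OF \<theta>(1)]) auto
  then obtain c where c: "\<theta> p = ereal c" "c \<le> (a + a') / 2"
    using ab ab' \<theta>(2)[of p] by (cases "\<theta> p") (auto simp: field_simps)
  have "d p < ereal (1 - 1/2) * d u + ereal (1/2) * d w"
    unfolding p_def by (rule strictly_convex_fun_onD[OF d(1) u(1) w(1) \<open>u \<noteq> w\<close>]) auto
  then have q': "q < (b + b') / 2" using q ab ab' by (simp add: field_simps)
  have "ereal \<gamma> * \<theta> u + d u \<le> ereal \<gamma> * \<theta> p + d p" "ereal \<gamma> * \<theta> w + d w \<le> ereal \<gamma> * \<theta> p + d p"
    using u(2) w(2) by (simp_all add: is_arg_min_linorder)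
  then have "\<gamma> * a + b \<le> \<gamma> * c + q" "\<gamma> * a' + b' \<le> \<gamma> * c + q"
    by (simp_all add: ab ab' c(1) q)
  moreover have "\<gamma> * c \<le> \<gamma> * ((a + a') / 2)" using c(2) \<gamma> by simp
  ultimately show False using q' by (simp add: algebra_simps)
qed

section \<open>Bregman distances of Legendre functions\<close>

locale legendre_function =
  fixes f :: "'a::euclidean_space \<Rightarrow> ereal"
  assumes Gamma0: "f \<in> Gamma0" and legendre: "legendre f"
begin

abbreviation U :: "'a set" where "U \<equiv> interior (edom f)"

text \<open>The real-valued version of \<open>f\<close>, faithful on \<open>edom f\<close>; it turns
  extended-real estimates into real arithmetic.\<close>

definition F :: "'a \<Rightarrow> real" where "F = (\<lambda>x. real_of_ereal (f x))"

lemma not_MInf: "f x \<noteq> -\<infinity>" and lsc: "lsc_fun f" and convex: "convex_fun f"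
  using Gamma0 by (auto simp: Gamma0_def proper_fun_def)

lemma f_eq: "x \<in> edom f \<Longrightarrow> f x = ereal (F x)"
  using not_MInf[of x] by (cases "f x") (auto simp: edom_def F_def)

lemma U_edom: "x \<in> U \<Longrightarrow> x \<in> edom f"
  using interior_subset by blast

lemma convex_U: "convex U"
  by (intro convex_interior convex_edom convex not_MInf)

text \<open>The derivative is a linear functional, represented by the vector of its values on
  \<open>Basis\<close>. Uniqueness of derivatives then justifies the description in
  \<open>grad\<close>.\<close>

lemma gderiv_grad:
  assumes "y \<in> U"
  shows "GDERIV F y :> grad f y"
proof -
  from assms legendre have "F differentiable (at y)"
    by (simp add: legendre_def essentially_smooth_def F_def)
  then obtain D where D: "(F has_derivative D) (at y)"
    by (auto simp: differentiable_def)
  then have "linear D" by (rule has_derivative_linear)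
  define g where "g = (\<Sum>b\<in>Basis. D b *\<^sub>R b)"
  have "D h = h \<bullet> g" for h
  proof -
    have "D h = D (\<Sum>b\<in>Basis. (h \<bullet> b) *\<^sub>R b)" by (simp add: euclidean_representation)
    also have "\<dots> = (\<Sum>b\<in>Basis. (h \<bullet> b) *\<^sub>R D b)"
      using \<open>linear D\<close> by (simp add: linear_sum linear_cmul)
    also have "\<dots> = h \<bullet> g" by (simp add: g_def inner_sum_right mult.commute)
    finally show ?thesis .
  qed
  then have "D = (\<lambda>h. h \<bullet> g)" by auto
  with D have g: "GDERIV F y :> g" by (simp add: gderiv_def)
  have "g' = g" if "GDERIV F y :> g'" for g'
    using has_derivative_unique[OF that[unfolded gderiv_def] g[unfolded gderiv_def]]
    by (metis vector_eq_ldot)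
  with g show ?thesis unfolding grad_def F_def by (rule theI)
qed

lemma isCont_F: "y \<in> U \<Longrightarrow> isCont F y"
  using gderiv_grad[unfolded gderiv_def] has_derivative_continuous by blast

lemma tendsto_F: "y \<in> U \<Longrightarrow> (F \<longlongrightarrow> F y) (nhds y)"
  using isCont_F[of y] by (intro tendsto_at_iff_tendsto_nhds[where g = F, THEN iffD1]) (simp add: isCont_def)

text \<open>By convexity the difference quotients along the segment from \<open>y\<close> to
  \<open>x\<close> are at most \<open>F x - F y\<close>, and they tend to the directional derivative
  at \<open>y\<close>.\<close>

lemma gradient_inequality_real:
  assumes y: "y \<in> U" and x: "x \<in> edom f"
  shows "F y + grad f y \<bullet> (x - y) \<le> F x"
proof -
  define \<phi> where "\<phi> t = F (y + t *\<^sub>R (x - y))" for t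
  have "(F has_derivative (\<lambda>h. h \<bullet> grad f y)) (at (y + 0 *\<^sub>R (x - y)))"
    using gderiv_grad[OF y] by (simp add: gderiv_def)
  moreover have "((\<lambda>t. y + t *\<^sub>R (x - y)) has_derivative (\<lambda>t. t *\<^sub>R (x - y))) (at 0)"
    by (auto intro!: derivative_eq_intros)
  ultimately have "(\<phi> has_derivative (\<lambda>t. (t *\<^sub>R (x - y)) \<bullet> grad f y)) (at 0)"
    unfolding \<phi>_def using has_derivative_compose by fastforce
  then have "(\<phi> has_field_derivative (grad f y \<bullet> (x - y))) (at 0)"
    by (simp add: has_field_derivative_def inner_commute mult_commute_abs)
  then have "((\<lambda>t. (\<phi> t - \<phi> 0) / t) \<longlongrightarrow> grad f y \<bullet> (x - y)) (at_right 0)"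
    unfolding has_field_derivative_iff by (auto intro: tendsto_mono[OF at_le])
  moreover have "\<forall>\<^sub>F t in at_right 0. (\<phi> t - \<phi> 0) / t \<le> F x - F y"
  proof (rule eventually_mono[OF eventually_at_right_real[of 0 1]])
    fix t :: real assume t: "t \<in> {0<..<1}"
    have p: "y + t *\<^sub>R (x - y) = (1 - t) *\<^sub>R y + t *\<^sub>R x" by (simp add: algebra_simps)
    have "f ((1 - t) *\<^sub>R y + t *\<^sub>R x) \<le> ereal (1 - t) * f y + ereal t * f x"
      using t by (intro convex_funD[OF convex]) auto
    then have *: "f (y + t *\<^sub>R (x - y)) \<le> ereal ((1 - t) * F y + t * F x)"
      unfolding p by (simp add: f_eq[OF x] f_eq[OF U_edom[OF y]])
    then have "y + t *\<^sub>R (x - y) \<in> edom f" by (auto simp: edom_def elim: le_less_trans)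
    with * have "\<phi> t \<le> (1 - t) * F y + t * F x"
      by (simp add: \<phi>_def f_eq)
    then show "(\<phi> t - \<phi> 0) / t \<le> F x - F y"
      using t by (simp add: \<phi>_def field_simps)
  qed simp
  ultimately have "grad f y \<bullet> (x - y) \<le> F x - F y"
    by (intro tendsto_upperbound[where F = "at_right 0"]) auto
  then show ?thesis by simp
qed

lemma bregman_eq:
  assumes "y \<in> U"
  shows "bregman f x y = f x + ereal (- F y - grad f y \<bullet> (x - y))"
  using assms not_MInf[of x] f_eq[OF U_edom[OF assms]]
  by (cases "f x"; cases "f y") (auto simp: bregman_def)

lemma bregman_eq_real:
  assumes "y \<in> U" "x \<in> edom f"
  shows "bregman f x y = ereal (F x - F y - grad f y \<bullet> (x - y))"
  by (subst bregman_eq[OF assms(1)], subst f_eq[OF assms(2)]) simp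

lemma bregman_nonneg: "0 \<le> bregman f x y"
proof (cases "y \<in> U \<and> x \<in> edom f")
  case True
  then show ?thesis
    using gradient_inequality_real[of y x] by (simp add: bregman_eq_real)
next
  case False
  then consider "y \<notin> U" | "y \<in> U" "f x = \<infinity>" by (auto simp: edom_def)
  then show ?thesis
    by cases (simp_all add: bregman_eq, simp add: bregman_def)
qed

text \<open>Gradients are subgradients, so the convex set \<open>U\<close> is among those on which
  essential strict convexity applies.\<close>

lemma strictly_convex_U: "strictly_convex_fun_on U f"
proof -
  have "U \<subseteq> dom_subdiff f"
  proof
    fix y assume y: "y \<in> U"
    have "f y + ereal (grad f y \<bullet> (z - y)) \<le> f z" for z
    proof (cases "z \<in> edom f")
      case True
      then show ?thesis
        using gradient_inequality_real[OF y True]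
        by (subst f_eq[OF True], subst f_eq[OF U_edom[OF y]]) simp
    qed (simp add: edom_def)
    then show "y \<in> dom_subdiff f" by (auto simp: dom_subdiff_def)
  qed
  with legendre convex_U show ?thesis
    by (simp add: legendre_def essentially_strictly_convex_def)
qed

lemma bregman_eq_0_iff:
  assumes y: "y \<in> U"
  shows "bregman f x y = 0 \<longleftrightarrow> x = y"
proof
  assume 0: "bregman f x y = 0"
  then have x: "x \<in> edom f"
    using bregman_eq[OF y, of x] by (auto simp: edom_def)
  have Fx: "F x = F y + grad f y \<bullet> (x - y)"
    using 0 bregman_eq_real[OF y x] by (simp add: zero_ereal_def)
  show "x = y"
  proof (rule ccontr)
    assume "x \<noteq> y"
    define p where "p = (1 - 1/2) *\<^sub>R y + (1/2::real) *\<^sub>R x"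
    have comb: "(1 - t) *\<^sub>R y + t *\<^sub>R x = x - (1 - t) *\<^sub>R (x - y)"
      "(1 - t) *\<^sub>R y + t *\<^sub>R x - y = t *\<^sub>R (x - y)" for t
      by (simp_all add: algebra_simps)
    have p: "p \<in> U"
      unfolding p_def comb(1) using x y not_MInf
      by (intro mem_interior_convex_shrink convex_edom convex) auto
    have "p \<noteq> y" using comb(2)[of "1/2"] \<open>x \<noteq> y\<close> by (auto simp: p_def)
    have "f p \<le> ereal (1 - 1/2) * f y + ereal (1/2) * f x"
      unfolding p_def by (rule convex_funD[OF convex]) auto
    then have Fp: "F p \<le> F y + grad f y \<bullet> (p - y)"
      unfolding f_eq[OF x] f_eq[OF U_edom[OF y]] f_eq[OF U_edom[OF p]]
      by (simp add: Fx p_def field_simps inner_diff_right inner_add_right)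
    define q where "q = (1 - 1/2) *\<^sub>R y + (1/2::real) *\<^sub>R p"
    have q: "q \<in> U"
      unfolding q_def using convex_U y p by (intro convexD_alt) auto
    have "f q < ereal (1 - 1/2) * f y + ereal (1/2) * f p"
      unfolding q_def using \<open>p \<noteq> y\<close> by (intro strictly_convex_fun_onD[OF strictly_convex_U y p]) auto
    then have "F q < F y + grad f y \<bullet> (q - y)"
      unfolding f_eq[OF U_edom[OF y]] f_eq[OF U_edom[OF p]] f_eq[OF U_edom[OF q]]
      using Fp by (simp add: q_def field_simps inner_diff_right inner_add_right)
    with gradient_inequality_real[OF y U_edom[OF q]] show False by simp
  qed
qed (simp add: bregman_eq_real[OF y U_edom[OF y]] zero_ereal_def[symmetric])

section \<open>Growth of the gradient at the boundary\<close>

lemma gradient_bound: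
  assumes z: "z \<in> U"
  obtains e M where "0 < e" "\<And>v. v \<in> U \<Longrightarrow> F v + grad f v \<bullet> (z - v) + e * norm (grad f v) \<le> M"
proof -
  obtain e where e: "0 < e" "cball z e \<subseteq> U"
    using z open_contains_cball[of U] by auto
  have "continuous_on (cball z e) F"
    using e(2) by (intro continuous_at_imp_continuous_on ballI isCont_F) auto
  then have "bounded (F ` cball z e)"
    by (intro compact_imp_bounded compact_continuous_image) auto
  then obtain M where M: "\<And>x. x \<in> cball z e \<Longrightarrow> F x \<le> M"
    unfolding bounded_real by (metis abs_le_D1 imageI)
  have "F v + grad f v \<bullet> (z - v) + e * norm (grad f v) \<le> M" if v: "v \<in> U" for v
  proof -
    \<comment> \<open>The subgradient inequality at \<open>v\<close>, tested at the point of \<open>cball z e\<close> farthest along \<open>grad f v\<close>.\<close>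
    define w where "w = z + e *\<^sub>R sgn (grad f v)"
    have w: "w \<in> cball z e"
      using e(1) by (simp add: w_def dist_norm norm_sgn)
    have "F v + grad f v \<bullet> (w - v) \<le> F w"
      using gradient_inequality_real[OF v] w e(2) U_edom by blast
    moreover have "grad f v \<bullet> sgn (grad f v) = norm (grad f v)"
      by (cases "grad f v = 0")
        (simp_all add: sgn_div_norm power2_norm_eq_inner[symmetric] power2_eq_square)
    then have "grad f v \<bullet> (w - v) = grad f v \<bullet> (z - v) + e * norm (grad f v)"
      by (simp add: w_def inner_diff_right inner_add_right)
    ultimately show ?thesis using M[OF w] by simp
  qed
  with e(1) that show thesis by blast
qed

text \<open>A limit of points of \<open>U\<close> outside the open set \<open>U\<close> is a
  frontier point, which is where essential smoothness applies.\<close>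

lemma grad_at_top:
  assumes "\<And>n. s n \<in> U" "s \<longlonglongrightarrow> z" "z \<notin> U"
  shows "filterlim (\<lambda>n. norm (grad f (s n))) at_top sequentially"
proof -
  have "z \<in> closure U" using assms(1,2) closure_sequential by blast
  with assms(3) have "z \<in> frontier U" by (simp add: frontier_def)
  with assms(1,2) legendre show ?thesis
    unfolding legendre_def essentially_smooth_def by blast
qed

section \<open>Semicontinuity and limits of the Bregman distance\<close>

lemma lsc_bregman_left:
  assumes "y \<in> U"
  shows "lsc_fun (\<lambda>x. bregman f x y)"
  unfolding bregman_eq[OF assms]
proof (rule lsc_fun_add[OF lsc _ not_MInf])
  show "lsc_fun (\<lambda>x. ereal (- F y - grad f y \<bullet> (x - y)))"
    unfolding lsc_fun_eventually
  proof (intro allI impI)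
    fix x c assume c: "c < ereal (- F y - grad f y \<bullet> (x - y))"
    have "((\<lambda>x. ereal (- F y - grad f y \<bullet> (x - y))) \<longlongrightarrow> ereal (- F y - grad f y \<bullet> (x - y))) (nhds x)"
      by (intro tendsto_intros filterlim_ident)
    then show "\<forall>\<^sub>F z in nhds x. c < ereal (- F y - grad f y \<bullet> (z - y))"
      using c by (rule order_tendstoD)
  qed
qed simp

lemma eventually_U: "y \<in> U \<Longrightarrow> \<forall>\<^sub>F x in nhds y. x \<in> U"
  by (simp add: eventually_nhds_in_open)

lemma tendsto_bregman_left:
  assumes y: "y \<in> U"
  shows "((\<lambda>x. bregman f x y) \<longlongrightarrow> 0) (nhds y)"
proof -
  have "((\<lambda>x. ereal (F x - F y - grad f y \<bullet> (x - y))) \<longlongrightarrow> ereal (F y - F y - grad f y \<bullet> (y - y))) (nhds y)"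
    by (intro tendsto_intros filterlim_ident tendsto_F y)
  then have "((\<lambda>x. ereal (F x - F y - grad f y \<bullet> (x - y))) \<longlongrightarrow> 0) (nhds y)"
    by (simp add: zero_ereal_def)
  then show ?thesis
    by (rule Lim_transform_eventually)
      (use eventually_U[OF y] in \<open>auto elim!: eventually_mono simp: bregman_eq_real[OF y] U_edom\<close>)
qed

lemma tendsto_bregman_right:
  assumes x: "x \<in> U" and v: "v \<in> U" and cont: "isCont (grad f) v"
  shows "(bregman f x \<longlongrightarrow> bregman f x v) (nhds v)"
proof -
  have "(grad f \<longlongrightarrow> grad f v) (nhds v)"
    using cont by (simp add: isCont_def tendsto_at_iff_tendsto_nhds)
  then have "((\<lambda>y. ereal (F x - F y - grad f y \<bullet> (x - y))) \<longlongrightarrow> ereal (F x - F v - grad f v \<bullet> (x - v))) (nhds v)"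
    by (intro tendsto_intros filterlim_ident tendsto_F v)
  then show ?thesis
    unfolding bregman_eq_real[OF v U_edom[OF x], symmetric]
    by (rule Lim_transform_eventually)
      (use eventually_U[OF v] in \<open>auto elim!: eventually_mono simp: bregman_eq_real U_edom x\<close>)
qed

lemma lsc_bregman_right:
  assumes x: "x \<in> U" and cont: "\<And>v. v \<in> U \<Longrightarrow> isCont (grad f) v"
  shows "lsc_fun (bregman f x)"
  unfolding lsc_fun_eventually
proof (intro allI impI)
  fix v c assume c: "c < bregman f x v"
  show "\<forall>\<^sub>F y in nhds v. c < bregman f x y"
  proof (cases "v \<in> U")
    case True
    then show ?thesis
      using tendsto_bregman_right[OF x True cont[OF True]] c by (intro order_tendstoD)
  next
    case False
    with c have c': "c < \<infinity>" by (simp add: bregman_def)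
    then obtain C where C: "c < ereal C" using ereal_dense2 by blast
    obtain e M where eM: "0 < e"
      "\<And>v. v \<in> U \<Longrightarrow> F v + grad f v \<bullet> (x - v) + e * norm (grad f v) \<le> M"
      using gradient_bound[OF x] by blast
    \<comment> \<open>Off \<open>U\<close> the distance is infinite, so only approach from within
      \<open>U\<close> matters. There \<open>gradient_bound\<close> gives
      \<open>bregman f x y\<close> at least \<open>F x - M + e * norm (grad f y)\<close>, which
      blows up.\<close>
    have "\<forall>\<^sub>F y in inf (nhds v) (principal U). c < bregman f x y"
    proof (rule sequentially_imp_eventually_nhds_within, intro allI impI)
      fix s assume s: "(\<forall>n. s n \<in> U) \<and> s \<longlonglongrightarrow> v"
      then have "filterlim (\<lambda>n. norm (grad f (s n))) at_top sequentially"
        using grad_at_top False by blast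
      then have "\<forall>\<^sub>F n in sequentially. (C + M - F x) / e \<le> norm (grad f (s n))"
        by (simp add: filterlim_at_top)
      then show "\<forall>\<^sub>F n in sequentially. c < bregman f x (s n)"
      proof eventually_elim
        case (elim n)
        have sn: "s n \<in> U" using s by blast
        have "C + M - F x \<le> e * norm (grad f (s n))"
          using elim eM(1) by (simp add: pos_divide_le_eq mult.commute)
        with eM(2)[OF sn] have "C \<le> F x - F (s n) - grad f (s n) \<bullet> (x - s n)" by linarith
        then have "ereal C \<le> bregman f x (s n)"
          by (simp add: bregman_eq_real[OF sn U_edom[OF x]])
        with C show ?case by (rule less_le_trans)
      qed
    qed
    then have "\<forall>\<^sub>F y in nhds v. y \<in> U \<longrightarrow> c < bregman f x y"
      by (simp add: eventually_inf_principal)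
    then show ?thesis
      by eventually_elim (use c' in \<open>auto simp: bregman_def\<close>)
  qed
qed

section \<open>Strict convexity and interior minimizers on the left\<close>

lemma strictly_convex_bregman_left:
  assumes y: "y \<in> U"
  shows "strictly_convex_fun_on U (\<lambda>x. bregman f x y)"
  unfolding strictly_convex_fun_on_def
proof (intro conjI convex_U ballI impI)
  fix u w and t :: real
  assume u: "u \<in> U" and w: "w \<in> U" and t: "t \<in> {0<..<1}" and "u \<noteq> w"
  define p where "p = (1 - t) *\<^sub>R u + t *\<^sub>R w"
  have p: "p \<in> U" unfolding p_def using convex_U u w t by (intro convexD_alt) auto
  have "f p < ereal (1 - t) * f u + ereal t * f w"
    unfolding p_def using t \<open>u \<noteq> w\<close> by (intro strictly_convex_fun_onD[OF strictly_convex_U u w]) auto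
  then have "F p < (1 - t) * F u + t * F w"
    unfolding f_eq[OF U_edom[OF u]] f_eq[OF U_edom[OF w]] f_eq[OF U_edom[OF p]] by simp
  then have "bregman f p y < ereal (1 - t) * bregman f u y + ereal t * bregman f w y"
    unfolding bregman_eq_real[OF y U_edom[OF u]] bregman_eq_real[OF y U_edom[OF w]]
      bregman_eq_real[OF y U_edom[OF p]]
    by (simp add: p_def inner_diff_right inner_add_right algebra_simps)
  then show "bregman f ((1 - t) *\<^sub>R u + t *\<^sub>R w) y < ereal (1 - t) * bregman f u y + ereal t * bregman f w y"
    by (simp add: p_def)
qed

text \<open>In its left argument the distance may be finite on the boundary of \<open>U\<close>, so
  finiteness of the objective does not place minimizers in \<open>U\<close>. Uniqueness needs them
  there, because strict convexity is known on \<open>U\<close>.\<close>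

lemma left_minimizer_interior:
  assumes \<theta>: "convex_fun \<theta>" "\<And>x. \<theta> x \<noteq> -\<infinity>"
    and y: "y \<in> U" and z: "z \<in> U" "\<theta> z < \<infinity>" and \<gamma>: "0 < \<gamma>"
    and min: "is_arg_min (\<lambda>x. ereal \<gamma> * \<theta> x + bregman f x y) (\<lambda>x. True) u"
  shows "u \<in> U"
proof (rule ccontr)
  assume "u \<notin> U"
  obtain c where c: "\<theta> z = ereal c" using \<theta>(2)[of z] z(2) by (cases "\<theta> z") auto
  have le: "ereal \<gamma> * \<theta> u + bregman f u y \<le> ereal \<gamma> * \<theta> x + bregman f x y" for x
    using min by (simp add: is_arg_min_linorder)
  have "ereal \<gamma> * \<theta> u + bregman f u y < \<infinity>"
    using le[of z] bregman_eq_real[OF y U_edom[OF z(1)]] c by (auto elim: le_less_trans)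
  then obtain a where a: "\<theta> u = ereal a" and u: "u \<in> edom f"
    using \<theta>(2)[of u] \<gamma> not_MInf[of u] bregman_eq[OF y, of u]
    by (cases "\<theta> u"; cases "f u") (auto simp: edom_def)
  \<comment> \<open>If \<open>u\<close> were a boundary point, minimality along the segment towards \<open>z\<close> would bound the
    gradients of \<open>f\<close> on a sequence approaching \<open>u\<close>.\<close>
  define t :: "nat \<Rightarrow> real" where "t n = 1 / real (Suc n)" for n
  define s where "s n = u - t n *\<^sub>R (u - z)" for n
  have t: "0 < t n" "t n \<le> 1" for n by (simp_all add: t_def)
  have s: "s n \<in> U" for n
    unfolding s_def using t[of n] u z(1) not_MInf
    by (intro mem_interior_convex_shrink convex_edom convex) auto
  have "t \<longlonglongrightarrow> 0" unfolding t_def using LIMSEQ_inverse_real_of_nat by (simp add: inverse_eq_divide)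
  then have "s \<longlonglongrightarrow> u - 0 *\<^sub>R (u - z)" unfolding s_def by (intro tendsto_intros)
  then have lim: "filterlim (\<lambda>n. norm (grad f (s n))) at_top sequentially"
    using grad_at_top s \<open>u \<notin> U\<close> by simp
  obtain e M where eM: "0 < e"
    "\<And>v. v \<in> U \<Longrightarrow> F v + grad f v \<bullet> (z - v) + e * norm (grad f v) \<le> M"
    using gradient_bound[OF z(1)] by blast
  \<comment> \<open>\<open>K\<close> collects the first-order changes of the terms other than
    \<open>f\<close> along the segment and bounds \<open>G \<bullet> (z - u)\<close> from below.
    Inserting this and the tangent bound for \<open>F\<close> at \<open>z\<close> into
    \<open>gradient_bound\<close> leaves the constant \<open>B\<close>, independent of
    \<open>n\<close>.\<close>
  define K where "K = \<gamma> * (a - c) + grad f y \<bullet> (z - u)"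
  define B where "B = M - F z + norm (grad f z) * norm (u - z) + \<bar>K\<bar>"
  have bound: "e * norm (grad f (s n)) \<le> B" for n
  proof -
    define G where "G = grad f (s n)"
    have "F (s n) \<ge> F z + grad f z \<bullet> (s n - z)"
      by (rule gradient_inequality_real[OF z(1) U_edom[OF s]])
    also have sz: "s n - z = (1 - t n) *\<^sub>R (u - z)" by (simp add: s_def algebra_simps)
    finally have 1: "F (s n) \<ge> F z + (1 - t n) * (grad f z \<bullet> (u - z))" by simp
    have "\<bar>(1 - t n) * (grad f z \<bullet> (u - z))\<bar> \<le> 1 * (norm (grad f z) * norm (u - z))"
      unfolding abs_mult using t[of n]
      by (intro mult_mono Cauchy_Schwarz_ineq2) auto
    with 1 have 1: "F z - norm (grad f z) * norm (u - z) \<le> F (s n)" by linarith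
    have sn: "s n = (1 - t n) *\<^sub>R u + t n *\<^sub>R z" by (simp add: s_def algebra_simps)
    have "\<theta> (s n) \<le> ereal (1 - t n) * \<theta> u + ereal (t n) * \<theta> z"
    \<comment> \<open>For \<open>n = 0\<close> the weight is 1, outside the open interval of
      \<open>convex_fun\<close>; there \<open>s n\<close> is \<open>z\<close> itself.\<close>
    proof (cases "t n = 1")
      case False
      then show ?thesis unfolding sn using t[of n] by (intro convex_funD[OF \<theta>(1)]) auto
    qed (simp add: sn zero_ereal_def[symmetric] one_ereal_def[symmetric])
    then obtain b where b: "\<theta> (s n) = ereal b" "b \<le> (1 - t n) * a + t n * c"
      using a c \<theta>(2)[of "s n"] by (cases "\<theta> (s n)") auto
    have "\<gamma> * a + (F u - grad f y \<bullet> (u - y)) \<le> \<gamma> * b + (F (s n) - grad f y \<bullet> (s n - y))"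
      using le[of "s n"] a b(1) bregman_eq_real[OF y u] bregman_eq_real[OF y U_edom[OF s]] by simp
    moreover have "\<gamma> * b \<le> \<gamma> * ((1 - t n) * a + t n * c)" using b(2) \<gamma> by simp
    moreover have "F (s n) + G \<bullet> (u - s n) \<le> F u"
      unfolding G_def by (rule gradient_inequality_real[OF s u])
    moreover have "u - s n = t n *\<^sub>R (u - z)" by (simp add: s_def)
    then have "G \<bullet> (u - s n) = - (t n * (G \<bullet> (z - u)))"
      "grad f y \<bullet> (s n - y) = grad f y \<bullet> (u - y) + t n * (grad f y \<bullet> (z - u))"
      by (simp_all add: s_def algebra_simps inner_diff_right inner_add_right)
    \<comment> \<open>Minimality, convexity of \<open>\<theta>\<close> and the gradient inequality
      at \<open>s n\<close> combine so that all zeroth-order terms cancel and a factor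
      \<open>t n\<close> remains on both sides.\<close>
    ultimately have "t n * K \<le> t n * (G \<bullet> (z - u))"
      by (simp add: K_def algebra_simps)
    then have "K \<le> G \<bullet> (z - u)" using t[of n] by simp
    then have "(1 - t n) * K \<le> (1 - t n) * (G \<bullet> (z - u))"
      using t[of n] by (intro mult_left_mono) auto
    moreover have "\<bar>(1 - t n) * K\<bar> \<le> 1 * \<bar>K\<bar>"
      unfolding abs_mult using t[of n] by (intro mult_right_mono) auto
    moreover have "G \<bullet> (z - s n) = (1 - t n) * (G \<bullet> (z - u))"
      by (simp add: s_def algebra_simps inner_diff_right inner_add_right)
    ultimately have "- \<bar>K\<bar> \<le> G \<bullet> (z - s n)" by linarith
    with 1 eM(2)[OF s, of n] show ?thesis by (simp add: B_def G_def)
  qed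
  have "\<forall>\<^sub>F n in sequentially. (B + 1) / e \<le> norm (grad f (s n))"
    using lim by (simp add: filterlim_at_top)
  then obtain n where "(B + 1) / e \<le> norm (grad f (s n))"
    by (auto simp: eventually_sequentially)
  then have "B + 1 \<le> e * norm (grad f (s n))"
    using eM(1) by (simp add: pos_divide_le_eq mult.commute)
  with bound[of n] show False by simp
qed

end

text \<open>The upward arrow is encoded as antitonicity in \<gamma> plus the limit at
  \<open>at_right 0\<close>. The conditions relative to \<open>edom \<theta>\<close> exclude genuine
  failures. For \<open>f\<close> half the squared norm and \<theta> the indicator of a nonempty
  closed convex set missing \<open>y\<close>, \<theta> vanishes at all proximal points while
  \<open>\<theta> y\<close> is infinite. On the line, with \<theta> equal to 1/z for positive z and
  infinite elsewhere, the scaled distances at \<open>y = 0\<close> are half of \<gamma> to the power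
  -1/3 and diverge.\<close>

theorem theorem3p3:
  fixes f \<theta> :: "real ^ 'j \<Rightarrow> ereal" and x y :: "real ^ 'j" and U :: "(real ^ 'j) set"
  assumes f: "f \<in> Gamma0" "legendre f"
    and U: "U = interior (edom f)"
    and A1: "\<forall>v\<in>U. grad f differentiable (at v)" "continuous_on U (hessian f)"
    and A2: "convex_fun (\<lambda>p. bregman f (fst p) (snd p))"
    and A3: "\<forall>u\<in>U. strictly_convex_fun_on U (bregman f u)"
    and A4: "\<forall>u\<in>U. coercive_fun (bregman f u)"
    and \<theta>: "\<theta> \<in> Gamma0" "U \<inter> edom \<theta> \<noteq> {}"
    and xy: "x \<in> U" "y \<in> U"
  shows
    "(\<forall>\<mu>::real. 0 < \<mu> \<and> (\<forall>v\<in>U. coercive_fun (\<lambda>z. \<theta> z + ereal (1 / \<mu>) * bregman f z v)) \<longrightarrow>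
        antimono_on {0<..} (\<lambda>\<gamma>. left_env f \<theta> \<gamma> y) \<and>
        ((\<lambda>\<gamma>. left_env f \<theta> \<gamma> y) \<longlongrightarrow> \<theta> y) (at_right 0) \<and>
        antimono_on {0<..\<mu>} (\<lambda>\<gamma>. \<theta> (left_prox f \<theta> \<gamma> y)) \<and>
        (y \<in> closure (edom \<theta>) \<longrightarrow>
           ((\<lambda>\<gamma>. \<theta> (left_prox f \<theta> \<gamma> y)) \<longlongrightarrow> \<theta> y) (at_right 0)) \<and>
        (y \<in> edom \<theta> \<longrightarrow>
           ((\<lambda>\<gamma>. ereal (1 / \<gamma>) * bregman f (left_prox f \<theta> \<gamma> y) y) \<longlongrightarrow> 0) (at_right 0)))
     \<and>
     (\<forall>\<mu>::real. 0 < \<mu> \<and> (\<forall>u\<in>U. coercive_fun (\<lambda>z. \<theta> z + ereal (1 / \<mu>) * bregman f u z)) \<longrightarrow>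
        antimono_on {0<..} (\<lambda>\<gamma>. right_env f \<theta> \<gamma> x) \<and>
        ((\<lambda>\<gamma>. right_env f \<theta> \<gamma> x) \<longlongrightarrow> \<theta> x) (at_right 0) \<and>
        antimono_on {0<..\<mu>} (\<lambda>\<gamma>. \<theta> (right_prox f \<theta> \<gamma> x)) \<and>
        (x \<in> closure (edom \<theta>) \<longrightarrow>
           ((\<lambda>\<gamma>. \<theta> (right_prox f \<theta> \<gamma> x)) \<longlongrightarrow> \<theta> x) (at_right 0)) \<and>
        (x \<in> edom \<theta> \<longrightarrow>
           ((\<lambda>\<gamma>. ereal (1 / \<gamma>) * bregman f x (right_prox f \<theta> \<gamma> x)) \<longlongrightarrow> 0) (at_right 0)))"
proof -
  interpret legendre_function f using f by unfold_locales
  note [simp] = U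
  have th: "lsc_fun \<theta>" "convex_fun \<theta>" "\<And>x. \<theta> x \<noteq> -\<infinity>"
    using \<theta>(1) by (auto simp: Gamma0_def proper_fun_def)
  obtain z where z: "z \<in> U" "\<theta> z < \<infinity>" using \<theta>(2) by (auto simp: edom_def)
  have x: "x \<in> interior (edom f)" and y: "y \<in> interior (edom f)" and z': "z \<in> interior (edom f)"
    using xy z by auto
  have cont: "isCont (grad f) v" if "v \<in> interior (edom f)" for v
    using A1(1) that differentiable_imp_continuous_within by auto
  \<comment> \<open>Joint convexity, to be used with one coordinate held constant;
    \<open>same\<close> collapses the combination in that coordinate.\<close>
  have conv: "bregman f ((1 - t) *\<^sub>R a + t *\<^sub>R b) ((1 - t) *\<^sub>R a' + t *\<^sub>R b')
      \<le> ereal (1 - t) * bregman f a a' + ereal t * bregman f b b'" if "t \<in> {0<..<1}" for a b a' b' t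
    using convex_funD[OF A2, of t "(a, a')" "(b, b')"] that by simp
  have same: "(1 - t) *\<^sub>R v + t *\<^sub>R v = v" for t and v :: "real ^ 'j"
    by (simp flip: scaleR_left_distrib)
  have left: "penalty \<theta> (\<lambda>x. bregman f x y) y z \<mu>"
    if \<mu>: "0 < \<mu>" "coercive_fun (\<lambda>z. \<theta> z + ereal (1 / \<mu>) * bregman f z y)" for \<mu>
  proof
    show "convex_fun (\<lambda>x. bregman f x y)"
      using conv[where a' = y and b' = y] unfolding convex_fun_def same by blast
    show "bregman f z y < \<infinity>" using bregman_eq_real[OF y U_edom[OF z']] by simp
    fix \<gamma> u w
    assume "0 < \<gamma>" and u: "is_arg_min (\<lambda>x. ereal \<gamma> * \<theta> x + bregman f x y) (\<lambda>x. True) u"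
      and w: "is_arg_min (\<lambda>x. ereal \<gamma> * \<theta> x + bregman f x y) (\<lambda>x. True) w"
    show "u = w"
      by (rule strictly_convex_minimizer_unique[OF th(2,3) strictly_convex_bregman_left[OF y] _
            z' z(2) \<open>0 < \<gamma>\<close> left_minimizer_interior[OF th(2,3) y z' z(2) \<open>0 < \<gamma>\<close> u] u
            left_minimizer_interior[OF th(2,3) y z' z(2) \<open>0 < \<gamma>\<close> w] w])
        (simp add: bregman_eq_real[OF y] U_edom)
  qed (use th \<mu> z in \<open>simp_all add: bregman_nonneg bregman_eq_0_iff[OF y]
        lsc_bregman_left[OF y] tendsto_bregman_left[OF y]\<close>)
  have right: "penalty \<theta> (bregman f x) x z \<mu>"
    if \<mu>: "0 < \<mu>" "coercive_fun (\<lambda>z. \<theta> z + ereal (1 / \<mu>) * bregman f x z)" for \<mu>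
  proof
    show "convex_fun (bregman f x)"
      using conv[where a = x and b = x] unfolding convex_fun_def same by blast
    show "bregman f x z < \<infinity>" using bregman_eq_real[OF z' U_edom[OF x]] by simp
    show "bregman f x v = 0 \<longleftrightarrow> v = x" for v
      by (cases "v \<in> interior (edom f)") (auto simp: bregman_eq_0_iff x, simp add: bregman_def)
    show "(bregman f x \<longlongrightarrow> 0) (nhds x)"
      using tendsto_bregman_right[OF x x cont[OF x]] bregman_eq_0_iff[OF x, of x] by simp
    fix \<gamma> u w
    assume "0 < \<gamma>" and u: "is_arg_min (\<lambda>y. ereal \<gamma> * \<theta> y + bregman f x y) (\<lambda>x. True) u"
      and w: "is_arg_min (\<lambda>y. ereal \<gamma> * \<theta> y + bregman f x y) (\<lambda>x. True) w"
    have fin: "\<bar>bregman f x v\<bar> \<noteq> \<infinity>" if "v \<in> interior (edom f)" for v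
      using that bregman_eq_real[OF _ U_edom[OF x]] by simp
    \<comment> \<open>On the right side the distance is infinite outside \<open>U\<close>, so
      comparison with the finite value at \<open>z\<close> already places minimizers in
      \<open>U\<close>.\<close>
    have int: "v \<in> interior (edom f)"
      if "is_arg_min (\<lambda>y. ereal \<gamma> * \<theta> y + bregman f x y) (\<lambda>x. True) v" for v
    proof (rule ccontr)
      assume "v \<notin> interior (edom f)"
      then have "bregman f x v = \<infinity>" by (simp add: bregman_def)
      moreover have "ereal \<gamma> * \<theta> v + bregman f x v \<le> ereal \<gamma> * \<theta> z + bregman f x z"
        using that by (simp add: is_arg_min_linorder)
      ultimately show False
        using th(3)[of v] th(3)[of z] fin[OF z'] z(2) \<open>0 < \<gamma>\<close>
        by (cases "\<theta> v"; cases "\<theta> z"; cases "bregman f x z") auto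
    qed
    have "strictly_convex_fun_on (interior (edom f)) (bregman f x)" using A3 x by simp
    then show "u = w"
      by (rule strictly_convex_minimizer_unique[OF th(2,3) _ fin z' z(2) \<open>0 < \<gamma>\<close> int[OF u] u int[OF w] w])
  qed (use th \<mu> z in \<open>simp_all add: bregman_nonneg lsc_bregman_right[OF x cont]\<close>)
  show ?thesis
  proof (intro conjI allI impI; elim conjE)
    fix \<mu> :: real
    assume "0 < \<mu>" "\<forall>v\<in>U. coercive_fun (\<lambda>z. \<theta> z + ereal (1 / \<mu>) * bregman f z v)"
    then interpret penalty \<theta> "\<lambda>x. bregman f x y" y z \<mu>
      using left xy by blast
    note eqs = left_env_def env_def left_prox_def prox_def
    show "antimono_on {0<..} (\<lambda>\<gamma>. left_env f \<theta> \<gamma> y)"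
      using antimono_env unfolding eqs .
    show "((\<lambda>\<gamma>. left_env f \<theta> \<gamma> y) \<longlongrightarrow> \<theta> y) (at_right 0)"
      using env_tendsto unfolding eqs .
    show "antimono_on {0<..\<mu>} (\<lambda>\<gamma>. \<theta> (left_prox f \<theta> \<gamma> y))"
      using antimono_theta_prox unfolding eqs .
    show "((\<lambda>\<gamma>. \<theta> (left_prox f \<theta> \<gamma> y)) \<longlongrightarrow> \<theta> y) (at_right 0)" if "y \<in> closure (edom \<theta>)"
      using theta_prox_tendsto[OF that] unfolding eqs .
    show "((\<lambda>\<gamma>. ereal (1 / \<gamma>) * bregman f (left_prox f \<theta> \<gamma> y) y) \<longlongrightarrow> 0) (at_right 0)"
      if "y \<in> edom \<theta>"
      using d_prox_over_tendsto[OF that] unfolding eqs .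
  next
    fix \<mu> :: real
    assume "0 < \<mu>" "\<forall>u\<in>U. coercive_fun (\<lambda>z. \<theta> z + ereal (1 / \<mu>) * bregman f u z)"
    then interpret penalty \<theta> "bregman f x" x z \<mu>
      using right xy by blast
    note eqs = right_env_def env_def right_prox_def prox_def
    show "antimono_on {0<..} (\<lambda>\<gamma>. right_env f \<theta> \<gamma> x)"
      using antimono_env unfolding eqs .
    show "((\<lambda>\<gamma>. right_env f \<theta> \<gamma> x) \<longlongrightarrow> \<theta> x) (at_right 0)"
      using env_tendsto unfolding eqs .
    show "antimono_on {0<..\<mu>} (\<lambda>\<gamma>. \<theta> (right_prox f \<theta> \<gamma> x))"
      using antimono_theta_prox unfolding eqs .
    show "((\<lambda>\<gamma>. \<theta> (right_prox f \<theta> \<gamma> x)) \<longlongrightarrow> \<theta> x) (at_right 0)" if "x \<in> closure (edom \<theta>)"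
      using theta_prox_tendsto[OF that] unfolding eqs .
    show "((\<lambda>\<gamma>. ereal (1 / \<gamma>) * bregman f x (right_prox f \<theta> \<gamma> x)) \<longlongrightarrow> 0) (at_right 0)"
      if "x \<in> edom \<theta>"
      using d_prox_over_tendsto[OF that] unfolding eqs .
  qed
qed

end
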